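(* Let $p,q\in(1,2)$ with $p<q$. There exist constants $c,C>0$ depending only on $p$ and $q$ such that the following holds. Let $n,m\ge 1$ be integers, let $\xi_1,\dots,\xi_n$ be independent copies of a $q$-stable random variable $\xi$ on a probability space $(\Omega_1,\mathfrak{A}_1,\mathbb{P}_1)$, and let $\eta_1,\dots,\eta_m$ be independent copies of a $p$-stable random variable $\eta$ on a probability space $(\Omega_2,\mathfrak{A}_2,\mathbb{P}_2)$. Then, for all real matrices $(a_{ij})_{i,j}\in\mathbb{R}^{n\times m}$, $$c\left(\sum_{j=1}^m\Big(\sum_{i=1}^n|a_{ij}|^q\Big)^{p/q}\right)^{1/p}\le \mathbb{E}_{\Omega_1}\mathbb{E}_{\Omega_2}\max_{1\le i\le n,\,1\le j\le m}\left|a_{ij}\,\eta_j(\omega_2)\,\xi_i(\omega_1)\right|\le C\left(\sum_{j=1}^m\Big(\sum_{i=1}^n|a_{ij}|^q\Big)^{p/q}\right)^{1/p}.$$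
   Context: $\mathbb{E}_{\Omega_k}$ denotes expectation (integration) over $(\Omega_k,\mathfrak{A}_k,\mathbb{P}_k)$ in the variable $\omega_k$, $k=1,2$. For $r\in(1,2)$, an $r$-stable random variable means a (symmetric, normalized) real random variable $X$ with characteristic function $\mathbb{E}e^{itX}=e^{-|t|^r}$ for all $t\in\mathbb{R}$. *)

theory Defs
  imports "HOL-Probability.Probability"
begin

(* char is the characteristic function of a measure on the reals, applied here to the law of X. *)
definition stable_rv :: "'a measure \<Rightarrow> real \<Rightarrow> ('a \<Rightarrow> real) \<Rightarrow> bool" where
  "stable_rv M r X \<longleftrightarrow>
     X \<in> borel_measurable M \<and>
     (\<forall>t. char (distr M borel X) t = complex_of_real (exp (- (\<bar>t\<bar> powr r))))"

definition indep_copies :: "'a measure \<Rightarrow> ('a \<Rightarrow> real) \<Rightarrow> 'i set \<Rightarrow> ('i \<Rightarrow> 'a \<Rightarrow> real) \<Rightarrow> bool" where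
  "indep_copies M X I Y \<longleftrightarrow>
     prob_space.indep_vars M (\<lambda>_. borel) Y I \<and>
     (\<forall>i\<in>I. distr M borel (Y i) = distr M borel X)"

definition mixed_norm :: "real \<Rightarrow> real \<Rightarrow> nat \<Rightarrow> nat \<Rightarrow> (nat \<Rightarrow> nat \<Rightarrow> real) \<Rightarrow> real" where
  "mixed_norm p q n m a =
     (\<Sum>j=1..m. (\<Sum>i=1..n. \<bar>a i j\<bar> powr q) powr (p / q)) powr (1 / p)"

(* The expectations are integrals of nonnegative functions with values in [0, \<infinity>], so finiteness is
   part of the upper bound and the lower bound does not rely on a convention for divergent integrals. *)
definition expected_max ::
  "'a measure \<Rightarrow> 'b measure \<Rightarrow> nat \<Rightarrow> nat \<Rightarrow> (nat \<Rightarrow> nat \<Rightarrow> real) \<Rightarrow>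
   (nat \<Rightarrow> 'a \<Rightarrow> real) \<Rightarrow> (nat \<Rightarrow> 'b \<Rightarrow> real) \<Rightarrow> ennreal" where
  "expected_max M1 M2 n m a \<xi> \<eta> =
     (\<integral>\<^sup>+ \<omega>1. (\<integral>\<^sup>+ \<omega>2.
        ennreal (MAX (i, j)\<in>{1..n} \<times> {1..m}. \<bar>a i j * \<eta> j \<omega>2 * \<xi> i \<omega>1\<bar>) \<partial>M2) \<partial>M1)"

definition two_sided_estimate ::
  "real \<Rightarrow> real \<Rightarrow> real \<Rightarrow> real \<Rightarrow> 'a measure \<Rightarrow> 'b measure \<Rightarrow> bool" where
  "two_sided_estimate p q c C M1 M2 \<longleftrightarrow>
     (\<forall>n\<ge>1. \<forall>m\<ge>1. \<forall>\<xi>0 \<xi> \<eta>0 \<eta>.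
        stable_rv M1 q \<xi>0 \<and> indep_copies M1 \<xi>0 {1..n} \<xi> \<and>
        stable_rv M2 p \<eta>0 \<and> indep_copies M2 \<eta>0 {1..m} \<eta> \<longrightarrow>
        (\<forall>a. ennreal (c * mixed_norm p q n m a) \<le> expected_max M1 M2 n m a \<xi> \<eta> \<and>
             expected_max M1 M2 n m a \<xi> \<eta> \<le> ennreal (C * mixed_norm p q n m a)))"

end

theory Submission
  imports Defs
begin

text \<open>
  Let \<open>X\<close> be \<open>r\<close>-stable with \<open>r < 2\<close>. The identity \<open>E (1 - cos (u * X)) = 1 - exp (- \<bar>u\<bar> powr r)\<close>
  yields two facts on the tails: the part of the moment of order \<open>k\<close> with \<open>0 < k < r\<close> where \<open>\<bar>X\<bar> \<ge> s\<close> is at most a constant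
  times \<open>s powr (k - r)\<close> (\<open>stable_truncated_moment_le\<close>), and \<open>\<bar>X\<bar> \<ge> s\<close> has probability at least a constant
  times \<open>s powr - r\<close> for \<open>s \<ge> 1\<close> (\<open>stable_tail_ge\<close>).

  Consequently, the moment of order \<open>k < r\<close> of the maximum of the \<open>\<bar>b i * X i\<bar>\<close> is at most a
  constant times the \<open>k\<close>-th power of the \<open>r\<close>-norm of \<open>b\<close> (\<open>stable_max_moment_le_norm\<close>). For independent
  \<open>X i\<close>, the expectation of the maximum is at least a constant times this norm (\<open>stable_expected_max_ge\<close>).

  In the matrix problem put \<open>Z j = (MAX i. \<bar>a i j * \<xi> i\<bar>)\<close>. The maximum over all pairs is the maximum of
  the \<open>Z j * \<bar>\<eta> j\<bar>\<close>. Given the \<open>\<xi> i\<close>, its expectation is therefore comparable to the \<open>p\<close>-norm of the vector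
  \<open>Z\<close>. The expectation of that norm is at most the \<open>p\<close>-th root of the sum of the expectations of the
  \<open>Z j powr p\<close>, and at least the \<open>p\<close>-norm of the vector of expectations of the \<open>Z j\<close>. As \<open>p < q\<close>, the
  estimates for \<open>q\<close>-stable maxima with the moments of orders \<open>p\<close> and 1 show that both are comparable to the mixed norm
  (\<open>nested_expected_max_le\<close>, \<open>nested_expected_max_ge\<close>).

  The resulting constants are given by formulas in \<open>p\<close> and \<open>q\<close>. That every pair valid for spaces over real sequences is
  valid for all spaces holds because the expectation depends only on the joint laws of the two
  families, and these laws live on the space of real sequences.
\<close>

section \<open>Quadratic bounds for 1 - cos\<close>

lemma one_minus_cos_half: "1 - cos x = 2 * (sin (x / 2))\<^sup>2" for x :: real
  using cos_double_sin[of "x / 2"] by simp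

lemma one_minus_cos_le: "1 - cos x \<le> x\<^sup>2 / 2" for x :: real
proof -
  have "\<bar>sin (x/2)\<bar> \<le> \<bar>x/2\<bar>" by (rule abs_sin_x_le_abs_x)
  then have "(sin (x/2))\<^sup>2 \<le> (x/2)\<^sup>2" by (simp only: abs_le_square_iff)
  then show ?thesis by (simp add: one_minus_cos_half power_divide)
qed

lemma one_minus_cos_ge:
  fixes x :: real
  assumes "\<bar>x\<bar> \<le> 1"
  shows "x\<^sup>2 / 4 \<le> 1 - cos x"
proof -
  have "\<bar>sin y - y\<bar> \<le> \<bar>y\<bar> ^ 3 / 6" for y :: real
    using Maclaurin_sin_bound[of y 3] by (simp add: numeral_3_eq_3 sin_coeff_def)
  from this[of "x/2"] have 1: "\<bar>x/2\<bar> - \<bar>x/2\<bar> ^ 3 / 6 \<le> \<bar>sin (x/2)\<bar>" by linarith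
  have "\<bar>x/2\<bar> ^ 3 = \<bar>x/2\<bar> * \<bar>x/2\<bar>\<^sup>2" by (simp add: power3_eq_cube power2_eq_square)
  also have "\<dots> \<le> \<bar>x/2\<bar> * 1"
    using assms by (intro mult_left_mono) (auto simp: abs_square_le_1)
  finally have "3/4 * \<bar>x/2\<bar> \<le> \<bar>sin (x/2)\<bar>" using 1 by linarith
  then have "(3/4 * \<bar>x/2\<bar>)\<^sup>2 \<le> \<bar>sin (x/2)\<bar>\<^sup>2" by (intro power_mono) auto
  then have "9/16 * (x\<^sup>2 / 4) \<le> (sin (x/2))\<^sup>2" by (simp add: power2_eq_square)
  then show ?thesis using one_minus_cos_half[of x] zero_le_power2[of x] by linarith
qed

section \<open>Tails of a stable variable\<close>

text \<open>
  All information on the law of \<open>X\<close> enters the proof through this identity, the real part of the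
  characteristic function. The right-hand side is of the order of \<open>\<bar>u\<bar> powr r\<close> for small \<open>u\<close>.
\<close>
lemma (in prob_space) nn_integral_one_minus_cos_stable:
  assumes "stable_rv M r X"
  shows "(\<integral>\<^sup>+\<omega>. ennreal (1 - cos (u * X \<omega>)) \<partial>M) = ennreal (1 - exp (- (\<bar>u\<bar> powr r)))"
proof -
  have [measurable]: "X \<in> borel_measurable M" using assms by (simp add: stable_rv_def)
  have int: "integrable M (\<lambda>\<omega>. cos (u * X \<omega>))"
    by (rule integrable_const_bound[where B=1]) auto
  have inte: "integrable M (\<lambda>\<omega>. iexp (u * X \<omega>))"
    by (rule integrable_const_bound[where B=1]) auto
  have "char (distr M borel X) u = (CLINT \<omega>|M. iexp (u * X \<omega>))"
    unfolding char_def by (subst integral_distr) auto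
  then have "(CLINT \<omega>|M. iexp (u * X \<omega>)) = complex_of_real (exp (- (\<bar>u\<bar> powr r)))"
    using assms by (simp add: stable_rv_def)
  then have "Re (CLINT \<omega>|M. iexp (u * X \<omega>)) = exp (- (\<bar>u\<bar> powr r))" by simp
  moreover have "Re (CLINT \<omega>|M. iexp (u * X \<omega>)) = (\<integral>\<omega>. cos (u * X \<omega>) \<partial>M)"
    by (subst integral_Re[OF inte, symmetric]) (simp add: Re_exp)
  ultimately have "(\<integral>\<omega>. 1 - cos (u * X \<omega>) \<partial>M) = 1 - exp (- (\<bar>u\<bar> powr r))"
    using int by (simp add: prob_space)
  then show ?thesis
    using int by (subst nn_integral_eq_integral) auto
qed

text \<open>
  For \<open>s \<le> \<bar>x\<bar>\<close> the function \<open>\<bar>x\<bar> powr k\<close> is at most 32 times the integral of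
  \<open>(1 - cos (u * x)) * u powr (- 1 - k)\<close> over \<open>0 \<le> u \<le> 1 / s\<close>: already the part
  \<open>1 / (2 * \<bar>x\<bar>) \<le> u \<le> 1 / \<bar>x\<bar>\<close>, where \<open>1 - cos (u * x) \<ge> 1/16\<close>, contributes enough.
  Taking expectations under the integral sign replaces \<open>1 - cos (u * X)\<close> by at most \<open>u powr r\<close>,
  and what remains is a convergent power integral because \<open>k < r\<close>.
\<close>
lemma (in prob_space) stable_truncated_moment_le:
  assumes X: "stable_rv M r X" and k: "0 < k" "k < r" and s: "0 < s"
  shows "(\<integral>\<^sup>+\<omega>. ennreal (\<bar>X \<omega>\<bar> powr k * indicator {\<omega>. s \<le> \<bar>X \<omega>\<bar>} \<omega>) \<partial>M)
           \<le> ennreal (32 / (r - k) * s powr (k - r))"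
proof -
  have [measurable]: "X \<in> borel_measurable M" using X by (simp add: stable_rv_def)
  define f where "f = (\<lambda>u x::real. 32 * ((1 - cos (u * x)) * u powr (- 1 - k)) * indicator {0..1/s} u)"
  have f0: "0 \<le> f u x" for u x unfolding f_def by (simp add: indicator_def)
  have [measurable]: "(\<lambda>(x, u). f u x) \<in> borel_measurable (borel \<Otimes>\<^sub>M borel)"
    unfolding f_def by measurable
  \<comment> \<open>With \<open>y = \<bar>x\<bar>\<close>, \<open>f\<close> is at least \<open>2 * y powr (1 + k)\<close> on an interval of length \<open>1 / (2 * y)\<close>.\<close>
  have point: "ennreal (\<bar>x\<bar> powr k * indicator {x. s \<le> \<bar>x\<bar>} x) \<le> (\<integral>\<^sup>+u. ennreal (f u x) \<partial>lborel)" for x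
  proof (cases "s \<le> \<bar>x\<bar>")
    case True
    define y where "y = \<bar>x\<bar>"
    have y: "s \<le> y" "0 < y" using True s by (auto simp: y_def)
    have cosy: "cos (u * x) = cos (u * y)" for u unfolding y_def by (cases "x \<ge> 0") auto
    have low: "2 * y powr (1 + k) * indicator {1/(2*y)..1/y} u \<le> f u x" for u
    proof (cases "u \<in> {1/(2*y)..1/y}")
      case True
      then have u0: "0 < u" using y by (auto intro: less_le_trans[of 0 "1/(2*y)"])
      have u: "1/2 \<le> u * y" "u * y \<le> 1"
        using True y by (auto simp: field_simps)
      have "1/y \<le> 1/s" using y s by (simp add: frac_le)
      then have us: "u \<in> {0..1/s}" using True u by auto
      have "(1/2)\<^sup>2 / 4 \<le> (u*y)\<^sup>2 / 4" using u by (intro divide_right_mono power_mono) auto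
      also have "\<dots> \<le> 1 - cos (u * x)" using one_minus_cos_ge[of "u*y"] u u0 y cosy by simp
      finally have 1: "1/16 \<le> 1 - cos (u * x)" by (simp add: power2_eq_square)
      have "y powr (1 + k) = (1/y) powr (- 1 - k)"
        using y by (simp add: inverse_eq_divide[symmetric] inverse_powr powr_minus[symmetric] add.commute)
      also have "\<dots> \<le> u powr (- 1 - k)"
        using u0 True k y by (intro powr_mono2') auto
      finally have "1/16 * y powr (1+k) \<le> (1 - cos (u * x)) * u powr (- 1 - k)"
        using 1 by (intro mult_mono) auto
      then show ?thesis using True us by (simp add: f_def)
    qed (use f0 in auto)
    have "ennreal (\<bar>x\<bar> powr k * indicator {x. s \<le> \<bar>x\<bar>} x) = ennreal (y powr k)"
      using True by (simp add: y_def)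
    also have "y powr k = 2 * y powr (1 + k) * (1/y - 1/(2*y))"
      using y by (simp add: powr_add field_simps)
    also have "ennreal \<dots> = ennreal (2 * y powr (1 + k)) * emeasure lborel {1/(2*y)..1/y}"
    proof -
      have "1 / (2*y) \<le> 1 / y" using y by (simp add: frac_le)
      then show ?thesis by (simp only: emeasure_lborel_Icc) (rule ennreal_mult, use y in auto)
    qed
    also have "\<dots> = (\<integral>\<^sup>+u. ennreal (2 * y powr (1 + k)) * indicator {1/(2*y)..1/y} u \<partial>lborel)"
      by (subst nn_integral_cmult_indicator) auto
    also have "\<dots> \<le> (\<integral>\<^sup>+u. ennreal (f u x) \<partial>lborel)"
    proof (rule nn_integral_mono)
      fix u
      show "ennreal (2 * y powr (1 + k)) * indicator {1/(2*y)..1/y} u \<le> ennreal (f u x)"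
        using low[of u]
        by (cases "u \<in> {1/(2*y)..1/y}") (auto intro!: ennreal_leI simp del: atLeastAtMost_iff)
    qed
    finally show ?thesis .
  qed auto
  have "(\<integral>\<^sup>+\<omega>. ennreal (\<bar>X \<omega>\<bar> powr k * indicator {\<omega>. s \<le> \<bar>X \<omega>\<bar>} \<omega>) \<partial>M)
         \<le> (\<integral>\<^sup>+\<omega>. (\<integral>\<^sup>+u. ennreal (f u (X \<omega>)) \<partial>lborel) \<partial>M)"
    using point[of "X _"] by (intro nn_integral_mono) (simp add: indicator_def)
  also have "\<dots> = (\<integral>\<^sup>+u. (\<integral>\<^sup>+\<omega>. ennreal (f u (X \<omega>)) \<partial>M) \<partial>lborel)"
  proof -
    interpret pair_sigma_finite M lborel ..
    show ?thesis by (rule Fubini'[symmetric]) measurable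
  qed
  also have "\<dots> \<le> (\<integral>\<^sup>+u. ennreal (32 * u powr (r - k - 1)) * indicator {0..1/s} u \<partial>lborel)"
  proof (intro nn_integral_mono)
    fix u :: real
    show "(\<integral>\<^sup>+\<omega>. ennreal (f u (X \<omega>)) \<partial>M) \<le> ennreal (32 * u powr (r - k - 1)) * indicator {0..1/s} u"
    proof (cases "u \<in> {0..1/s}")
      case True
      have "(\<integral>\<^sup>+\<omega>. ennreal (f u (X \<omega>)) \<partial>M)
             = (\<integral>\<^sup>+\<omega>. ennreal (32 * u powr (- 1 - k)) * ennreal (1 - cos (u * X \<omega>)) \<partial>M)"
        using True by (intro nn_integral_cong) (simp add: f_def ennreal_mult'[symmetric] mult_ac)
      also have "\<dots> = ennreal (32 * u powr (- 1 - k)) * ennreal (1 - exp (- (\<bar>u\<bar> powr r)))"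
        by (subst nn_integral_cmult) (auto simp: nn_integral_one_minus_cos_stable[OF X])
      also have "\<dots> \<le> ennreal (32 * u powr (- 1 - k)) * ennreal (u powr r)"
        using True exp_ge_add_one_self[of "- (u powr r)"] by (intro mult_left_mono ennreal_leI) auto
      also have "\<dots> = ennreal (32 * u powr (r - k - 1))"
        by (simp add: ennreal_mult'[symmetric] powr_add[symmetric] algebra_simps)
      finally show ?thesis using True by simp
    qed (simp add: f_def)
  qed
  also have "\<dots> = ennreal (32 * ((1/s) powr (r - k) / (r - k)))"
  proof (rule nn_integral_has_integral_lebesgue')
    show "((\<lambda>u. 32 * u powr (r - k - 1)) has_integral 32 * ((1/s) powr (r - k) / (r - k))) {0..1/s}"
      using has_integral_mult_right[OF has_integral_powr_from_0[of "r - k - 1" "1/s"], of 32] k s by simp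
  qed simp
  also have "(1/s) powr (r - k) = s powr (k - r)"
    using s by (simp add: powr_divide powr_diff)
  finally show ?thesis by simp
qed

text \<open>
  This is \<open>d\<^sup>2\<close> for the positive solution \<open>d\<close> of \<open>d powr r = 8 * d\<^sup>2\<close>; the tail bound below compares the
  characteristic function at \<open>1 / s\<close> and at \<open>d / s\<close>.
\<close>
definition tail_const :: "real \<Rightarrow> real"
  where "tail_const r = ((1/8) powr (1 / (2 - r)))\<^sup>2"

text \<open>
  The expectation of \<open>1 - cos (d / s * X)\<close> is of order \<open>d powr r * s powr - r\<close>. Where \<open>\<bar>X\<bar> < s\<close>, this
  function is at most \<open>2 * d\<^sup>2 * (1 - cos (X / s))\<close>, which has expectation at most
  \<open>2 * d\<^sup>2 * s powr - r\<close>. As \<open>r < 2\<close>, the first quantity dominates for small \<open>d\<close>, so the event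
  \<open>s \<le> \<bar>X\<bar>\<close> has to account for a fixed part of it.
\<close>
lemma (in prob_space) stable_tail_ge:
  assumes X: "stable_rv M r X" and r: "0 < r" "r < 2" and s: "1 \<le> s"
  shows "tail_const r * s powr (-r) \<le> prob {\<omega> \<in> space M. s \<le> \<bar>X \<omega>\<bar>}"
proof -
  have [measurable]: "X \<in> borel_measurable M" using X by (simp add: stable_rv_def)
  define d :: real where "d = (1/8) powr (1 / (2 - r))"
  have d: "0 < d" "d \<le> 1" using r by (auto simp: d_def powr_le1)
  have "d powr (2 - r) = 1/8" using r by (simp add: d_def powr_powr)
  then have d2: "d powr r = 8 * d\<^sup>2" using d by (simp add: powr_diff field_simps)
  define E where "E = {\<omega> \<in> space M. s \<le> \<bar>X \<omega>\<bar>}"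
  have [measurable]: "E \<in> sets M" unfolding E_def by measurable
  have point: "1 - cos (d / s * X \<omega>) \<le> 2 * indicator E \<omega> + 2 * d\<^sup>2 * (1 - cos (1 / s * X \<omega>))"
    if "\<omega> \<in> space M" for \<omega>
  proof (cases "s \<le> \<bar>X \<omega>\<bar>")
    case True
    have "1 - cos (d / s * X \<omega>) \<le> 2" using cos_ge_minus_one[of "d / s * X \<omega>"] by linarith
    moreover have "0 \<le> 2 * d\<^sup>2 * (1 - cos (1 / s * X \<omega>))" by simp
    moreover have "indicator E \<omega> = (1::real)" using True that by (simp add: E_def)
    ultimately show ?thesis by linarith
  next
    case False
    then have "\<bar>1 / s * X \<omega>\<bar> \<le> 1" using s by (simp add: abs_mult)
    from one_minus_cos_ge[OF this] have "2 * d\<^sup>2 * ((1 / s * X \<omega>)\<^sup>2 / 4) \<le> 2 * d\<^sup>2 * (1 - cos (1 / s * X \<omega>))"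
      by (intro mult_left_mono) auto
    moreover have "1 - cos (d / s * X \<omega>) \<le> (d / s * X \<omega>)\<^sup>2 / 2" by (rule one_minus_cos_le)
    moreover have "indicator E \<omega> = (0::real)" using False by (simp add: E_def)
    moreover have "(d / s * X \<omega>)\<^sup>2 / 2 = 2 * d\<^sup>2 * ((1 / s * X \<omega>)\<^sup>2 / 4)"
      by (simp add: power_mult_distrib power_divide)
    ultimately show ?thesis by linarith
  qed
  have "ennreal (1 - exp (- (\<bar>d / s\<bar> powr r))) = (\<integral>\<^sup>+\<omega>. ennreal (1 - cos (d / s * X \<omega>)) \<partial>M)"
    by (rule nn_integral_one_minus_cos_stable[OF X, symmetric])
  also have "\<dots> \<le> (\<integral>\<^sup>+\<omega>. ennreal 2 * indicator E \<omega> + ennreal (2 * d\<^sup>2) * ennreal (1 - cos (1 / s * X \<omega>)) \<partial>M)"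
  proof (rule nn_integral_mono)
    fix \<omega> assume "\<omega> \<in> space M"
    from ennreal_leI[OF point[OF this]]
    show "ennreal (1 - cos (d / s * X \<omega>)) \<le> ennreal 2 * indicator E \<omega> + ennreal (2 * d\<^sup>2) * ennreal (1 - cos (1 / s * X \<omega>))"
      by (simp add: ennreal_mult'[symmetric] ennreal_plus[symmetric] ennreal_indicator[symmetric]
            del: ennreal_plus ennreal_numeral ennreal_indicator)
  qed
  also have "\<dots> = ennreal 2 * emeasure M E + ennreal (2 * d\<^sup>2) * ennreal (1 - exp (- (\<bar>1 / s\<bar> powr r)))"
    by (subst nn_integral_add)
       (auto simp: nn_integral_cmult nn_integral_cmult_indicator nn_integral_one_minus_cos_stable[OF X]
             simp del: ennreal_numeral times_divide_eq_left)
  also have "\<dots> = ennreal (2 * prob E + 2 * d\<^sup>2 * (1 - exp (- (\<bar>1 / s\<bar> powr r))))"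
    by (simp add: emeasure_eq_measure ennreal_mult'[symmetric] ennreal_plus[symmetric]
          del: ennreal_plus ennreal_numeral)
  finally have "1 - exp (- (\<bar>d / s\<bar> powr r)) \<le> 2 * prob E + 2 * d\<^sup>2 * (1 - exp (- (\<bar>1 / s\<bar> powr r)))"
    by (subst (asm) ennreal_le_iff) auto
  moreover have "2 * d\<^sup>2 * (1 - exp (- (\<bar>1 / s\<bar> powr r))) \<le> 2 * d\<^sup>2 * s powr (-r)"
    using s exp_ge_add_one_self[of "- ((1/s) powr r)"]
    by (intro mult_left_mono) (auto simp: powr_divide powr_minus_divide)
  moreover have "4 * d\<^sup>2 * s powr (-r) \<le> 1 - exp (- (\<bar>d / s\<bar> powr r))"
  proof -
    define v where "v = (d / s) powr r"
    have v: "0 \<le> v" "v \<le> 1" using d s r by (auto simp: v_def powr_le1)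
    \<comment> \<open>For \<open>v\<close> in the unit interval, \<open>(1 - v / 2) * (1 + v) \<ge> 1\<close> gives \<open>1 - exp (- v) \<ge> v / 2\<close>.\<close>
    have "v * v \<le> v" using v by (simp add: mult_left_le)
    then have "1 \<le> (1 - v / 2) * (1 + v)" by (simp add: algebra_simps)
    also have "\<dots> \<le> (1 - v / 2) * exp v" using v by (intro mult_left_mono) auto
    finally have "exp (- v) \<le> 1 - v / 2" by (simp add: exp_minus field_simps)
    moreover have "v = 8 * d\<^sup>2 * s powr (-r)" using d s by (simp add: v_def powr_divide powr_minus_divide d2)
    ultimately have "4 * d\<^sup>2 * s powr (-r) \<le> 1 - exp (- v)" by linarith
    then show ?thesis using d s by (simp add: v_def)
  qed
  ultimately have "d\<^sup>2 * s powr (-r) \<le> prob E" by linarith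
  then show ?thesis by (simp add: tail_const_def d_def E_def)
qed

section \<open>Maxima of weighted stable variables\<close>

lemma (in prob_space) stable_scaled_truncated_moment_le:
  assumes X: "stable_rv M r X" and k: "0 < k" "k < r" and N: "0 < N"
  shows "(\<integral>\<^sup>+\<omega>. ennreal (\<bar>b * X \<omega>\<bar> powr k * indicator {\<omega>. N \<le> \<bar>b * X \<omega>\<bar>} \<omega>) \<partial>M)
           \<le> ennreal (32 / (r - k) * N powr (k - r) * \<bar>b\<bar> powr r)"
proof (cases "b = 0")
  case True
  then show ?thesis using k by simp
next
  case False
  have [measurable]: "X \<in> borel_measurable M" using X by (simp add: stable_rv_def)
  have "(\<integral>\<^sup>+\<omega>. ennreal (\<bar>b * X \<omega>\<bar> powr k * indicator {\<omega>. N \<le> \<bar>b * X \<omega>\<bar>} \<omega>) \<partial>M)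
     = (\<integral>\<^sup>+\<omega>. ennreal (\<bar>b\<bar> powr k) * ennreal (\<bar>X \<omega>\<bar> powr k * indicator {\<omega>. N / \<bar>b\<bar> \<le> \<bar>X \<omega>\<bar>} \<omega>) \<partial>M)"
    using False
    by (intro nn_integral_cong)
       (auto simp: ennreal_mult'[symmetric] abs_mult powr_mult indicator_def field_simps)
  also have "\<dots> = ennreal (\<bar>b\<bar> powr k) * (\<integral>\<^sup>+\<omega>. ennreal (\<bar>X \<omega>\<bar> powr k * indicator {\<omega>. N / \<bar>b\<bar> \<le> \<bar>X \<omega>\<bar>} \<omega>) \<partial>M)"
    unfolding indicator_def by (subst nn_integral_cmult) auto
  also have "\<dots> \<le> ennreal (\<bar>b\<bar> powr k) * ennreal (32 / (r - k) * (N / \<bar>b\<bar>) powr (k - r))"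
    using False N by (intro mult_left_mono stable_truncated_moment_le[OF X k]) auto
  also have "\<dots> = ennreal (\<bar>b\<bar> powr k * (32 / (r - k) * (N / \<bar>b\<bar>) powr (k - r)))"
    using k by (intro ennreal_mult'[symmetric]) simp
  also have "\<bar>b\<bar> powr k * (32 / (r - k) * (N / \<bar>b\<bar>) powr (k - r)) = 32 / (r - k) * N powr (k - r) * \<bar>b\<bar> powr r"
    using False N by (simp add: powr_divide powr_diff)
  finally show ?thesis .
qed

text \<open>
  A maximum exceeding the level \<open>N\<close> is one of the terms that exceed \<open>N\<close>, hence is bounded by the sum of
  all these terms. The level is left free because the matrix estimate uses the same \<open>N\<close> for all
  random weights \<open>b\<close>.
\<close>
lemma (in prob_space) stable_max_moment_le:
  assumes I: "finite I" "I \<noteq> {}"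
    and X: "\<And>i. i \<in> I \<Longrightarrow> stable_rv M r (X i)" and k: "0 < k" "k < r" and N: "0 < N"
  shows "(\<integral>\<^sup>+\<omega>. ennreal ((MAX i\<in>I. \<bar>b i * X i \<omega>\<bar>) powr k) \<partial>M)
           \<le> ennreal (N powr k + 32 / (r - k) * N powr (k - r) * (\<Sum>i\<in>I. \<bar>b i\<bar> powr r))"
proof -
  have [measurable]: "i \<in> I \<Longrightarrow> X i \<in> borel_measurable M" for i using X by (simp add: stable_rv_def)
  define T where "T = (\<lambda>i \<omega>. \<bar>b i * X i \<omega>\<bar> powr k * indicator {\<omega>. N \<le> \<bar>b i * X i \<omega>\<bar>} \<omega>)"
  have T0: "0 \<le> T i \<omega>" for i \<omega> by (simp add: T_def)
  have "(MAX i\<in>I. \<bar>b i * X i \<omega>\<bar>) powr k \<le> N powr k + (\<Sum>i\<in>I. T i \<omega>)" for \<omega>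
  proof -
    have "(MAX i\<in>I. \<bar>b i * X i \<omega>\<bar>) \<in> (\<lambda>i. \<bar>b i * X i \<omega>\<bar>) ` I" using I by (intro Max_in) auto
    then obtain i where i: "i \<in> I" "(MAX i\<in>I. \<bar>b i * X i \<omega>\<bar>) = \<bar>b i * X i \<omega>\<bar>" by auto
    have "\<bar>b i * X i \<omega>\<bar> powr k \<le> N powr k + T i \<omega>"
      using k by (cases "N \<le> \<bar>b i * X i \<omega>\<bar>") (auto simp: T_def intro!: powr_mono2)
    also have "T i \<omega> \<le> (\<Sum>i\<in>I. T i \<omega>)" using I i T0 by (intro member_le_sum) auto
    finally show ?thesis using i by simp
  qed
  then have "(\<integral>\<^sup>+\<omega>. ennreal ((MAX i\<in>I. \<bar>b i * X i \<omega>\<bar>) powr k) \<partial>M)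
      \<le> (\<integral>\<^sup>+\<omega>. ennreal (N powr k) + (\<Sum>i\<in>I. ennreal (T i \<omega>)) \<partial>M)"
    using T0 by (intro nn_integral_mono) (simp add: sum_nonneg ennreal_plus[symmetric] ennreal_leI del: ennreal_plus)
  also have "\<dots> = ennreal (N powr k) + (\<Sum>i\<in>I. \<integral>\<^sup>+\<omega>. ennreal (T i \<omega>) \<partial>M)"
    by (subst nn_integral_add; (subst nn_integral_sum)?) (auto simp: T_def indicator_def emeasure_space_1)
  also have "\<dots> \<le> ennreal (N powr k) + (\<Sum>i\<in>I. ennreal (32 / (r - k) * N powr (k - r) * \<bar>b i\<bar> powr r))"
    unfolding T_def by (intro add_left_mono sum_mono stable_scaled_truncated_moment_le X k N)
  also have "\<dots> = ennreal (N powr k + 32 / (r - k) * N powr (k - r) * (\<Sum>i\<in>I. \<bar>b i\<bar> powr r))"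
    using k by (simp add: sum_ennreal sum_distrib_left ennreal_plus[symmetric] sum_nonneg del: ennreal_plus)
  finally show ?thesis .
qed

text \<open>The level \<open>N = (\<Sum>i\<in>I. \<bar>b i\<bar> powr r) powr (1 / r)\<close> balances the two summands.\<close>
corollary (in prob_space) stable_max_moment_le_norm:
  assumes I: "finite I" "I \<noteq> {}"
    and X: "\<And>i. i \<in> I \<Longrightarrow> stable_rv M r (X i)" and k: "0 < k" "k < r"
  shows "(\<integral>\<^sup>+\<omega>. ennreal ((MAX i\<in>I. \<bar>b i * X i \<omega>\<bar>) powr k) \<partial>M)
           \<le> ennreal ((1 + 32 / (r - k)) * (\<Sum>i\<in>I. \<bar>b i\<bar> powr r) powr (k / r))"
proof (cases "(\<Sum>i\<in>I. \<bar>b i\<bar> powr r) = 0")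
  case True
  then have "\<forall>i\<in>I. b i = 0" using I by (subst (asm) sum_nonneg_eq_0_iff) auto
  then have "(MAX i\<in>I. \<bar>b i * X i \<omega>\<bar>) = 0" for \<omega>
    using I by (intro Max_eqI) auto
  then show ?thesis by simp
next
  case False
  define S where "S = (\<Sum>i\<in>I. \<bar>b i\<bar> powr r)"
  have S: "S > 0" using False sum_nonneg[of I "\<lambda>i. \<bar>b i\<bar> powr r"] by (simp add: S_def)
  have "(S powr (1/r)) powr (k - r) * S = S powr (k / r)"
    using S k by (simp add: powr_powr diff_divide_distrib powr_diff)
  then have "(S powr (1/r)) powr k + 32 / (r - k) * (S powr (1/r)) powr (k - r) * S
     = (1 + 32 / (r - k)) * S powr (k / r)"
    by (simp add: powr_powr distrib_right)
  then show ?thesis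
    using stable_max_moment_le[OF I X k, where N = "S powr (1/r)" and b = b] S by (simp add: S_def)
qed

text \<open>
  Let \<open>B\<close> be the \<open>r\<close>-norm of \<open>b\<close>. Each \<open>\<bar>b i\<bar>\<close> is at most \<open>B\<close>, so the tail bound applies at
  \<open>s = B / \<bar>b i\<bar>\<close> and shows that \<open>\<bar>b i * X i\<bar>\<close> reaches \<open>B\<close> with probability at least a constant times
  \<open>\<bar>b i\<bar> powr r / B powr r\<close>. These fractions add up to 1; by independence, all terms stay below \<open>B\<close>
  with probability at most \<open>exp (- tail_const r)\<close>.
\<close>
lemma (in prob_space) stable_expected_max_ge:
  assumes I: "finite I" "I \<noteq> {}" and ind: "indep_vars (\<lambda>_. borel) X I"
    and X: "\<And>i. i \<in> I \<Longrightarrow> stable_rv M r (X i)" and r: "0 < r" "r < 2"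
  shows "ennreal ((1 - exp (- tail_const r)) * (\<Sum>i\<in>I. \<bar>b i\<bar> powr r) powr (1 / r))
           \<le> (\<integral>\<^sup>+\<omega>. ennreal (MAX i\<in>I. \<bar>b i * X i \<omega>\<bar>) \<partial>M)"
proof (cases "(\<Sum>i\<in>I. \<bar>b i\<bar> powr r) = 0")
  case False
  have [measurable]: "i \<in> I \<Longrightarrow> X i \<in> borel_measurable M" for i using X by (simp add: stable_rv_def)
  define S where "S = (\<Sum>i\<in>I. \<bar>b i\<bar> powr r)"
  have S: "S > 0" using False sum_nonneg[of I "\<lambda>i. \<bar>b i\<bar> powr r"] by (simp add: S_def)
  define B where "B = S powr (1 / r)"
  have B: "B > 0" "B powr r = S" using S r by (auto simp: B_def powr_powr)
  have c: "0 \<le> tail_const r" by (simp add: tail_const_def)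
  define A where "A = (\<Inter>i\<in>I. X i -` {x. \<bar>b i * x\<bar> < B} \<inter> space M)"
  have As: "A \<in> sets M" unfolding A_def using I by (intro sets.finite_INT) auto
  have one: "prob (X i -` {x. \<bar>b i * x\<bar> < B} \<inter> space M) \<le> exp (- (tail_const r * (\<bar>b i\<bar> powr r / S)))"
    if i: "i \<in> I" for i
  proof (cases "b i = 0")
    case False
    have "\<bar>b i\<bar> powr r \<le> S" unfolding S_def using I i by (intro member_le_sum) auto
    then have "\<bar>b i\<bar> \<le> B" using B r powr_less_mono2[of r B "\<bar>b i\<bar>"] by force
    then have "1 \<le> B / \<bar>b i\<bar>" using False by simp
    from stable_tail_ge[OF X[OF i] r this]
    have t: "tail_const r * (\<bar>b i\<bar> powr r / S) \<le> prob {\<omega> \<in> space M. B / \<bar>b i\<bar> \<le> \<bar>X i \<omega>\<bar>}"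
      using B by (simp add: powr_minus powr_divide field_simps)
    have "X i -` {x. \<bar>b i * x\<bar> < B} \<inter> space M = space M - {\<omega> \<in> space M. B / \<bar>b i\<bar> \<le> \<bar>X i \<omega>\<bar>}"
      using False by (auto simp: abs_mult field_simps)
    then have "prob (X i -` {x. \<bar>b i * x\<bar> < B} \<inter> space M) = 1 - prob {\<omega> \<in> space M. B / \<bar>b i\<bar> \<le> \<bar>X i \<omega>\<bar>}"
      using i by (simp add: prob_compl)
    also have "\<dots> \<le> 1 - tail_const r * (\<bar>b i\<bar> powr r / S)" using t by simp
    also have "\<dots> \<le> exp (- (tail_const r * (\<bar>b i\<bar> powr r / S)))"
      using exp_ge_add_one_self[of "- (tail_const r * (\<bar>b i\<bar> powr r / S))"] by simp
    finally show ?thesis .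
  qed simp
  have "prob A = (\<Prod>i\<in>I. prob (X i -` {x. \<bar>b i * x\<bar> < B} \<inter> space M))"
    unfolding A_def using I by (intro indep_varsD[OF ind]) auto
  also have "\<dots> \<le> (\<Prod>i\<in>I. exp (- (tail_const r * (\<bar>b i\<bar> powr r / S))))"
    using one by (intro prod_mono) auto
  also have "\<dots> = exp (- tail_const r)"
    using I S by (simp add: exp_sum[symmetric] sum_negf sum_distrib_left[symmetric] sum_divide_distrib[symmetric] S_def)
  finally have "1 - exp (- tail_const r) \<le> prob (space M - A)" using As by (simp add: prob_compl)
  then have "ennreal ((1 - exp (- tail_const r)) * B) \<le> ennreal B * emeasure M (space M - A)"
    using B by (simp add: emeasure_eq_measure ennreal_mult'[symmetric] mult.commute)
  also have "\<dots> = (\<integral>\<^sup>+\<omega>. ennreal B * indicator (space M - A) \<omega> \<partial>M)"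
    using As by (subst nn_integral_cmult_indicator) auto
  also have "\<dots> \<le> (\<integral>\<^sup>+\<omega>. ennreal (MAX i\<in>I. \<bar>b i * X i \<omega>\<bar>) \<partial>M)"
  proof (rule nn_integral_mono)
    fix \<omega> assume w: "\<omega> \<in> space M"
    have "B \<le> (MAX i\<in>I. \<bar>b i * X i \<omega>\<bar>)" if "\<omega> \<notin> A"
    proof -
      have "\<exists>i\<in>I. B \<le> \<bar>b i * X i \<omega>\<bar>" using that w I by (auto simp: A_def not_less)
      then show ?thesis using I by (subst Max_ge_iff) auto
    qed
    then show "ennreal B * indicator (space M - A) \<omega> \<le> ennreal (MAX i\<in>I. \<bar>b i * X i \<omega>\<bar>)"
      using w by (auto simp: indicator_def intro: ennreal_leI)
  qed
  finally show ?thesis by (simp add: B_def S_def)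
qed simp

section \<open>The estimates for matrices\<close>

text \<open>
  Hoelder's inequality against the norming functional of \<open>A\<close>: for \<open>Z = A\<close> both sides agree. It
  linearises the \<open>p\<close>-norm of a random vector in the lower bound below.
\<close>
lemma Holder_inequality_sum_dual:
  fixes A Z :: "'i \<Rightarrow> real"
  assumes J: "finite J" and p: "1 < p"
    and A: "\<And>j. j \<in> J \<Longrightarrow> 0 \<le> A j" and Z: "\<And>j. j \<in> J \<Longrightarrow> 0 \<le> Z j"
  shows "(\<Sum>j\<in>J. A j powr (p - 1) * Z j)
           \<le> (\<Sum>j\<in>J. A j powr p) powr ((p - 1) / p) * (\<Sum>j\<in>J. Z j powr p) powr (1 / p)"
proof (cases "(\<Sum>j\<in>J. A j powr p) = 0 \<or> (\<Sum>j\<in>J. Z j powr p) = 0")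
  case True
  then have "(\<forall>j\<in>J. A j = 0) \<or> (\<forall>j\<in>J. Z j = 0)"
    using J by (simp add: sum_nonneg_eq_0_iff)
  then have "(\<Sum>j\<in>J. A j powr (p - 1) * Z j) = 0" by auto
  then show ?thesis by simp
next
  case False
  define N where "N = (\<Sum>j\<in>J. A j powr p) powr (1 / p)"
  define T where "T = (\<Sum>j\<in>J. Z j powr p) powr (1 / p)"
  have pos: "0 < (\<Sum>j\<in>J. A j powr p)" "0 < (\<Sum>j\<in>J. Z j powr p)"
    using False sum_nonneg[of J "\<lambda>j. A j powr p"] sum_nonneg[of J "\<lambda>j. Z j powr p"] by auto
  have NT: "0 < N" "0 < T" "N powr p = (\<Sum>j\<in>J. A j powr p)" "T powr p = (\<Sum>j\<in>J. Z j powr p)"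
    using pos p unfolding N_def T_def by (auto simp: powr_powr)
  have young: "(A j / N) powr (p - 1) * (Z j / T) \<le> (A j / N) powr p * (1 - 1 / p) + (Z j / T) powr p / p"
    if j: "j \<in> J" for j
  proof -
    have "(Z j / T) * (A j / N) powr (p - 1)
        \<le> (Z j / T) powr p / p + ((A j / N) powr (p - 1)) powr (p / (p - 1)) / (p / (p - 1))"
      using p A[OF j] Z[OF j] NT by (intro Youngs_inequality) (auto simp: field_simps)
    also have "((A j / N) powr (p - 1)) powr (p / (p - 1)) = (A j / N) powr p"
      using p by (simp add: powr_powr)
    also have "(A j / N) powr p / (p / (p - 1)) = (A j / N) powr p * (1 - 1 / p)"
      using p by (simp add: field_simps)
    finally show ?thesis by (simp only: mult.commute[of "Z j / T"] add.commute)
  qed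
  have "(\<Sum>j\<in>J. (A j / N) powr (p - 1) * (Z j / T))
      \<le> (\<Sum>j\<in>J. (A j / N) powr p * (1 - 1 / p) + (Z j / T) powr p / p)"
    by (rule sum_mono) (rule young)
  also have "\<dots> = (\<Sum>j\<in>J. (A j / N) powr p) * (1 - 1 / p) + (\<Sum>j\<in>J. (Z j / T) powr p) / p"
    by (simp add: sum.distrib sum_distrib_right sum_divide_distrib)
  also have "(\<Sum>j\<in>J. (A j / N) powr p) = 1"
    using NT A pos by (simp add: powr_divide sum_divide_distrib[symmetric])
  also have "(\<Sum>j\<in>J. (Z j / T) powr p) = 1"
    using NT Z pos by (simp add: powr_divide sum_divide_distrib[symmetric])
  finally have "(\<Sum>j\<in>J. (A j / N) powr (p - 1) * (Z j / T)) \<le> 1" by simp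
  moreover have "(\<Sum>j\<in>J. (A j / N) powr (p - 1) * (Z j / T))
      = (\<Sum>j\<in>J. A j powr (p - 1) * Z j) / (N powr (p - 1) * T)"
    using NT A by (simp add: powr_divide sum_divide_distrib)
  ultimately have "(\<Sum>j\<in>J. A j powr (p - 1) * Z j) \<le> N powr (p - 1) * T"
    using NT by (simp add: divide_le_eq)
  then show ?thesis by (simp add: N_def T_def powr_powr)
qed

lemma Max_abs_product_eq:
  fixes a :: "'i \<Rightarrow> 'j \<Rightarrow> real"
  assumes I: "finite I" "I \<noteq> {}" and J: "finite J" "J \<noteq> {}"
  shows "(MAX (i, j)\<in>I \<times> J. \<bar>a i j * y j * x i\<bar>) = (MAX j\<in>J. \<bar>(MAX i\<in>I. \<bar>a i j * x i\<bar>) * y j\<bar>)"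
proof -
  have nonneg: "0 \<le> (MAX i\<in>I. \<bar>a i j * x i\<bar>)" for j
    using I by (subst Max_ge_iff) auto
  show ?thesis
  proof (rule antisym)
    have "\<bar>a i j * y j * x i\<bar> \<le> (MAX j\<in>J. \<bar>(MAX i\<in>I. \<bar>a i j * x i\<bar>) * y j\<bar>)"
      if "i \<in> I" "j \<in> J" for i j
    proof -
      have "\<bar>a i j * y j * x i\<bar> = \<bar>a i j * x i\<bar> * \<bar>y j\<bar>" by (simp add: abs_mult)
      also have "\<dots> \<le> (MAX i\<in>I. \<bar>a i j * x i\<bar>) * \<bar>y j\<bar>"
        using I that by (intro mult_right_mono Max_ge) auto
      also have "\<dots> = \<bar>(MAX i\<in>I. \<bar>a i j * x i\<bar>) * y j\<bar>"
        using nonneg[of j] by (simp add: abs_mult)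
      also have "\<dots> \<le> (MAX j\<in>J. \<bar>(MAX i\<in>I. \<bar>a i j * x i\<bar>) * y j\<bar>)"
        using J that by (intro Max_ge) auto
      finally show ?thesis .
    qed
    then show "(MAX (i, j)\<in>I \<times> J. \<bar>a i j * y j * x i\<bar>) \<le> (MAX j\<in>J. \<bar>(MAX i\<in>I. \<bar>a i j * x i\<bar>) * y j\<bar>)"
      using I J by (subst Max_le_iff) auto
  next
    have "\<bar>(MAX i\<in>I. \<bar>a i j * x i\<bar>) * y j\<bar> \<le> (MAX (i, j)\<in>I \<times> J. \<bar>a i j * y j * x i\<bar>)"
      if j: "j \<in> J" for j
    proof -
      have "(MAX i\<in>I. \<bar>a i j * x i\<bar>) \<in> (\<lambda>i. \<bar>a i j * x i\<bar>) ` I" using I by (intro Max_in) auto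
      then obtain i where i: "i \<in> I" "(MAX i\<in>I. \<bar>a i j * x i\<bar>) = \<bar>a i j * x i\<bar>" by auto
      have "\<bar>(MAX i\<in>I. \<bar>a i j * x i\<bar>) * y j\<bar> = \<bar>a i j * y j * x i\<bar>"
        using i(2) by (simp add: abs_mult)
      also have "\<dots> \<le> (MAX (i, j)\<in>I \<times> J. \<bar>a i j * y j * x i\<bar>)"
        using I J i j by (intro Max_ge) (auto intro!: image_eqI[of _ _ "(i, j)"])
      finally show ?thesis .
    qed
    then show "(MAX j\<in>J. \<bar>(MAX i\<in>I. \<bar>a i j * x i\<bar>) * y j\<bar>) \<le> (MAX (i, j)\<in>I \<times> J. \<bar>a i j * y j * x i\<bar>)"
      using J by (subst Max_le_iff) auto
  qed
qed

text \<open>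
  For fixed \<open>\<omega>1\<close> the inner integral is that of a maximum of \<open>p\<close>-stable variables with weights \<open>Z j\<close>.
  Estimating it at the level \<open>N\<close> of the final bound, and not at the level adapted to the weights, leaves an
  expression that is linear in \<open>Z j powr p\<close>. Its expectation is then controlled termwise by the moment of
  order \<open>p < q\<close> of a maximum of \<open>q\<close>-stable variables.
\<close>
lemma nested_expected_max_le:
  fixes a :: "'i \<Rightarrow> 'j \<Rightarrow> real"
  assumes M1: "prob_space M1" and M2: "prob_space M2" and pq: "1 < p" "p < q"
    and I: "finite I" "I \<noteq> {}" and J: "finite J" "J \<noteq> {}"
    and X: "\<And>i. i \<in> I \<Longrightarrow> stable_rv M1 q (X i)" and Y: "\<And>j. j \<in> J \<Longrightarrow> stable_rv M2 p (Y j)"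
  shows "(\<integral>\<^sup>+\<omega>1. \<integral>\<^sup>+\<omega>2. ennreal (MAX (i, j)\<in>I \<times> J. \<bar>a i j * Y j \<omega>2 * X i \<omega>1\<bar>) \<partial>M2 \<partial>M1)
    \<le> ennreal ((1 + 32 / (p - 1) * (1 + 32 / (q - p))) *
        (\<Sum>j\<in>J. (\<Sum>i\<in>I. \<bar>a i j\<bar> powr q) powr (p / q)) powr (1 / p))"
proof -
  interpret M1: prob_space M1 by fact
  interpret M2: prob_space M2 by fact
  have [measurable]: "i \<in> I \<Longrightarrow> X i \<in> borel_measurable M1" for i using X by (simp add: stable_rv_def)
  define S where "S = (\<Sum>j\<in>J. (\<Sum>i\<in>I. \<bar>a i j\<bar> powr q) powr (p / q))"
  have S0: "0 \<le> S" unfolding S_def by (intro sum_nonneg) auto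
  define Z where "Z = (\<lambda>j \<omega>. MAX i\<in>I. \<bar>a i j * X i \<omega>\<bar>)"
  have [measurable]: "Z j \<in> borel_measurable M1" for j
    unfolding Z_def using I by measurable
  have Z0: "0 \<le> Z j \<omega>" for j \<omega> unfolding Z_def using I by (subst Max_ge_iff) auto
  show ?thesis
  proof (cases "S = 0")
    case True
    then have "\<forall>j\<in>J. \<forall>i\<in>I. a i j = 0"
      using I J pq by (simp add: S_def sum_nonneg_eq_0_iff sum_nonneg)
    then have "(MAX (i, j)\<in>I \<times> J. \<bar>a i j * Y j \<omega>2 * X i \<omega>1\<bar>) = 0" for \<omega>1 \<omega>2
      using I J by (intro Max_eqI) (auto simp: image_iff)
    then show ?thesis by simp
  next
    case False
    define N where "N = S powr (1 / p)"
    have N: "0 < N" "N powr p = S" using False S0 pq by (auto simp: N_def powr_powr)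
    define K where "K = 32 / (p - 1)"
    have K: "0 \<le> K" using pq by (simp add: K_def)
    have inner: "(\<integral>\<^sup>+\<omega>2. ennreal (MAX (i, j)\<in>I \<times> J. \<bar>a i j * Y j \<omega>2 * X i \<omega>1\<bar>) \<partial>M2)
        \<le> ennreal (N + K * N powr (1 - p) * (\<Sum>j\<in>J. Z j \<omega>1 powr p))" for \<omega>1
    proof -
      have "(\<integral>\<^sup>+\<omega>2. ennreal (MAX (i, j)\<in>I \<times> J. \<bar>a i j * Y j \<omega>2 * X i \<omega>1\<bar>) \<partial>M2)
          = (\<integral>\<^sup>+\<omega>2. ennreal ((MAX j\<in>J. \<bar>Z j \<omega>1 * Y j \<omega>2\<bar>) powr 1) \<partial>M2)"
      proof (intro nn_integral_cong)
        fix \<omega>2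
        have "0 \<le> (MAX j\<in>J. \<bar>Z j \<omega>1 * Y j \<omega>2\<bar>)" using J by (subst Max_ge_iff) auto
        then show "ennreal (MAX (i, j)\<in>I \<times> J. \<bar>a i j * Y j \<omega>2 * X i \<omega>1\<bar>)
            = ennreal ((MAX j\<in>J. \<bar>Z j \<omega>1 * Y j \<omega>2\<bar>) powr 1)"
          unfolding Max_abs_product_eq[OF I J] Z_def by simp
      qed
      also have "\<dots> \<le> ennreal (N powr 1 + 32 / (p - 1) * N powr (1 - p) * (\<Sum>j\<in>J. \<bar>Z j \<omega>1\<bar> powr p))"
        using pq N J Y by (intro M2.stable_max_moment_le) auto
      finally show ?thesis using N Z0 by (simp add: K_def)
    qed
    have outer: "(\<integral>\<^sup>+\<omega>. ennreal (Z j \<omega> powr p) \<partial>M1)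
        \<le> ennreal ((1 + 32 / (q - p)) * (\<Sum>i\<in>I. \<bar>a i j\<bar> powr q) powr (p / q))" for j
      unfolding Z_def using pq I X by (intro M1.stable_max_moment_le_norm) auto
    have "(\<integral>\<^sup>+\<omega>1. \<integral>\<^sup>+\<omega>2. ennreal (MAX (i, j)\<in>I \<times> J. \<bar>a i j * Y j \<omega>2 * X i \<omega>1\<bar>) \<partial>M2 \<partial>M1)
        \<le> (\<integral>\<^sup>+\<omega>1. ennreal (N + K * N powr (1 - p) * (\<Sum>j\<in>J. Z j \<omega>1 powr p)) \<partial>M1)"
      by (rule nn_integral_mono) (rule inner)
    also have "\<dots> = (\<integral>\<^sup>+\<omega>1. ennreal N + ennreal (K * N powr (1 - p)) * (\<Sum>j\<in>J. ennreal (Z j \<omega>1 powr p)) \<partial>M1)"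
      using N K by (simp add: ennreal_mult sum_nonneg)
    also have "\<dots> = ennreal N + ennreal (K * N powr (1 - p)) * (\<Sum>j\<in>J. \<integral>\<^sup>+\<omega>. ennreal (Z j \<omega> powr p) \<partial>M1)"
      by (simp add: nn_integral_add nn_integral_cmult nn_integral_sum M1.emeasure_space_1 del: sum_ennreal)
    also have "\<dots> \<le> ennreal N + ennreal (K * N powr (1 - p)) *
        (\<Sum>j\<in>J. ennreal ((1 + 32 / (q - p)) * (\<Sum>i\<in>I. \<bar>a i j\<bar> powr q) powr (p / q)))"
      by (intro add_left_mono mult_left_mono sum_mono outer) auto
    also have "\<dots> = ennreal (N + K * N powr (1 - p) * ((1 + 32 / (q - p)) * S))"
      using N K S0 pq
      by (simp add: sum_ennreal S_def sum_distrib_left ennreal_mult'[symmetric] ennreal_plus[symmetric] sum_nonneg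
            del: ennreal_plus)
    also have "N + K * N powr (1 - p) * ((1 + 32 / (q - p)) * S) = (1 + K * (1 + 32 / (q - p))) * N"
    proof -
      have "N powr (1 - p) * S = N" using N by (simp add: powr_diff flip: N(2))
      then show ?thesis by (simp add: algebra_simps)
    qed
    finally show ?thesis by (simp add: N_def S_def K_def)
  qed
qed

text \<open>
  The inner integral is at least a constant times the \<open>p\<close>-norm of the vector \<open>(Z j)\<close>, and the expectation of a
  norm is at least the norm of the expectation: the norm is bounded below by the linear functional
  that norms \<open>A\<close>, and each \<open>Z j\<close> has expectation at least a constant times \<open>A j\<close>, the \<open>q\<close>-norm of
  column \<open>j\<close>.
\<close>
lemma nested_expected_max_ge:
  fixes a :: "'i \<Rightarrow> 'j \<Rightarrow> real"
  assumes M1: "prob_space M1" and M2: "prob_space M2" and pq: "1 < p" "p < 2" "0 < q" "q < 2"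
    and I: "finite I" "I \<noteq> {}" and J: "finite J" "J \<noteq> {}"
    and indX: "prob_space.indep_vars M1 (\<lambda>_. borel) X I"
    and indY: "prob_space.indep_vars M2 (\<lambda>_. borel) Y J"
    and X: "\<And>i. i \<in> I \<Longrightarrow> stable_rv M1 q (X i)" and Y: "\<And>j. j \<in> J \<Longrightarrow> stable_rv M2 p (Y j)"
  shows "ennreal ((1 - exp (- tail_const p)) * (1 - exp (- tail_const q)) *
        (\<Sum>j\<in>J. (\<Sum>i\<in>I. \<bar>a i j\<bar> powr q) powr (p / q)) powr (1 / p))
    \<le> (\<integral>\<^sup>+\<omega>1. \<integral>\<^sup>+\<omega>2. ennreal (MAX (i, j)\<in>I \<times> J. \<bar>a i j * Y j \<omega>2 * X i \<omega>1\<bar>) \<partial>M2 \<partial>M1)"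
proof -
  interpret M1: prob_space M1 by fact
  interpret M2: prob_space M2 by fact
  have [measurable]: "i \<in> I \<Longrightarrow> X i \<in> borel_measurable M1" for i using X by (simp add: stable_rv_def)
  define A where "A = (\<lambda>j. (\<Sum>i\<in>I. \<bar>a i j\<bar> powr q) powr (1 / q))"
  have A0: "0 \<le> A j" for j by (simp add: A_def)
  define S where "S = (\<Sum>j\<in>J. A j powr p)"
  have S_eq: "S = (\<Sum>j\<in>J. (\<Sum>i\<in>I. \<bar>a i j\<bar> powr q) powr (p / q))"
    by (simp add: S_def A_def powr_powr)
  have S0: "0 \<le> S" unfolding S_def by (intro sum_nonneg) auto
  define Z where "Z = (\<lambda>j \<omega>. MAX i\<in>I. \<bar>a i j * X i \<omega>\<bar>)"
  have [measurable]: "Z j \<in> borel_measurable M1" for j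
    unfolding Z_def using I by measurable
  have Z0: "0 \<le> Z j \<omega>" for j \<omega> unfolding Z_def using I by (subst Max_ge_iff) auto
  define cp cq where "cp = 1 - exp (- tail_const p)" and "cq = 1 - exp (- tail_const q)"
  have c: "0 \<le> cp" "0 \<le> cq" by (auto simp: cp_def cq_def tail_const_def)
  \<comment> \<open>The functional norming \<open>A\<close> has the coefficients \<open>W * A j powr (p - 1)\<close>.\<close>
  define W where "W = S powr ((1 - p) / p)"
  have W: "0 \<le> W" by (simp add: W_def)
  have inner: "ennreal (cp * W) * (\<Sum>j\<in>J. ennreal (A j powr (p - 1)) * ennreal (Z j \<omega>1))
      \<le> (\<integral>\<^sup>+\<omega>2. ennreal (MAX (i, j)\<in>I \<times> J. \<bar>a i j * Y j \<omega>2 * X i \<omega>1\<bar>) \<partial>M2)" for \<omega>1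
  proof -
    have "(\<Sum>j\<in>J. A j powr (p - 1) * Z j \<omega>1) \<le> S powr ((p - 1) / p) * (\<Sum>j\<in>J. Z j \<omega>1 powr p) powr (1 / p)"
      unfolding S_def using J pq A0 Z0 by (intro Holder_inequality_sum_dual) auto
    then have "W * (\<Sum>j\<in>J. A j powr (p - 1) * Z j \<omega>1)
        \<le> W * (S powr ((p - 1) / p) * (\<Sum>j\<in>J. Z j \<omega>1 powr p) powr (1 / p))"
      using W by (intro mult_left_mono)
    also have "\<dots> = (W * S powr ((p - 1) / p)) * (\<Sum>j\<in>J. Z j \<omega>1 powr p) powr (1 / p)" by simp
    also have "\<dots> \<le> 1 * (\<Sum>j\<in>J. Z j \<omega>1 powr p) powr (1 / p)"
      by (intro mult_right_mono) (auto simp: W_def powr_add[symmetric] diff_divide_distrib)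
    finally have "cp * (W * (\<Sum>j\<in>J. A j powr (p - 1) * Z j \<omega>1)) \<le> cp * (\<Sum>j\<in>J. Z j \<omega>1 powr p) powr (1 / p)"
      using c by (intro mult_left_mono) auto
    then have "ennreal (cp * (W * (\<Sum>j\<in>J. A j powr (p - 1) * Z j \<omega>1)))
        \<le> ennreal (cp * (\<Sum>j\<in>J. \<bar>Z j \<omega>1\<bar> powr p) powr (1 / p))"
      using Z0 by (intro ennreal_leI) simp
    also have "\<dots> \<le> (\<integral>\<^sup>+\<omega>2. ennreal (MAX j\<in>J. \<bar>Z j \<omega>1 * Y j \<omega>2\<bar>) \<partial>M2)"
      unfolding cp_def using pq J Y indY by (intro M2.stable_expected_max_ge) auto
    also have "\<dots> = (\<integral>\<^sup>+\<omega>2. ennreal (MAX (i, j)\<in>I \<times> J. \<bar>a i j * Y j \<omega>2 * X i \<omega>1\<bar>) \<partial>M2)"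
      unfolding Max_abs_product_eq[OF I J] Z_def ..
    also have "ennreal (cp * (W * (\<Sum>j\<in>J. A j powr (p - 1) * Z j \<omega>1)))
        = ennreal (cp * W) * (\<Sum>j\<in>J. ennreal (A j powr (p - 1)) * ennreal (Z j \<omega>1))"
      using c W Z0 by (simp add: ennreal_mult'[symmetric] sum_ennreal sum_nonneg mult.assoc)
    finally show ?thesis .
  qed
  have outer: "ennreal (cq * A j) \<le> (\<integral>\<^sup>+\<omega>. ennreal (Z j \<omega>) \<partial>M1)" for j
    unfolding Z_def A_def cq_def using pq I X indX by (intro M1.stable_expected_max_ge) auto
  have "W * S = S powr (1 / p)"
  proof (cases "S = 0")
    case False
    then have "W * S = W * S powr 1" using S0 by simp
    also have "\<dots> = S powr (1 / p)" unfolding W_def powr_add[symmetric] using pq by (simp add: diff_divide_distrib)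
    finally show ?thesis .
  qed (simp add: W_def)
  moreover have "(\<Sum>j\<in>J. A j powr (p - 1) * A j) = S"
    unfolding S_def using A0 by (intro sum.cong) (auto simp: powr_diff field_simps)
  moreover have "(\<Sum>j\<in>J. A j powr (p - 1) * (cq * A j)) = cq * (\<Sum>j\<in>J. A j powr (p - 1) * A j)"
    unfolding sum_distrib_left by (intro sum.cong) auto
  ultimately have "cp * cq * S powr (1 / p) = (cp * W) * (\<Sum>j\<in>J. A j powr (p - 1) * (cq * A j))"
    by (metis mult.assoc mult.commute)
  then have "ennreal (cp * cq * S powr (1 / p))
      = ennreal (cp * W) * (\<Sum>j\<in>J. ennreal (A j powr (p - 1)) * ennreal (cq * A j))"
    using c W A0 by (simp add: ennreal_mult'[symmetric] sum_ennreal sum_nonneg del: ennreal_mult')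
  also have "\<dots> \<le> ennreal (cp * W) * (\<Sum>j\<in>J. ennreal (A j powr (p - 1)) * (\<integral>\<^sup>+\<omega>. ennreal (Z j \<omega>) \<partial>M1))"
    by (intro mult_left_mono sum_mono outer) auto
  also have "\<dots> = (\<integral>\<^sup>+\<omega>1. ennreal (cp * W) * (\<Sum>j\<in>J. ennreal (A j powr (p - 1)) * ennreal (Z j \<omega>1)) \<partial>M1)"
    by (simp add: nn_integral_cmult nn_integral_sum)
  also have "\<dots> \<le> (\<integral>\<^sup>+\<omega>1. \<integral>\<^sup>+\<omega>2. ennreal (MAX (i, j)\<in>I \<times> J. \<bar>a i j * Y j \<omega>2 * X i \<omega>1\<bar>) \<partial>M2 \<partial>M1)"
    by (rule nn_integral_mono) (rule inner)
  finally show ?thesis by (simp add: S_eq cp_def cq_def)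
qed

section \<open>Transfer to the space of real sequences\<close>

text \<open>
  The two-sided estimate concerns only the joint laws of the families. Replacing a probability space by the joint law
  of a family on it, and the family by the coordinates, therefore moves the estimate from the type of
  real sequences to arbitrary types.
\<close>
definition joint_law :: "'a measure \<Rightarrow> (nat \<Rightarrow> 'a \<Rightarrow> real) \<Rightarrow> (nat \<Rightarrow> real) measure"
  where "joint_law M Y = distr M (\<Pi>\<^sub>M i\<in>UNIV. borel) (\<lambda>\<omega> i. Y i \<omega>)"

lemma measurable_process:
  assumes "\<And>i. Y i \<in> borel_measurable M"
  shows "(\<lambda>\<omega> i. Y i \<omega>) \<in> measurable M (\<Pi>\<^sub>M i\<in>(UNIV :: nat set). borel)"
  using assms by (intro measurable_PiM_single') auto

lemma prob_space_joint_law: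
  assumes "prob_space M" and "\<And>i. Y i \<in> borel_measurable M"
  shows "prob_space (joint_law M Y)"
  unfolding joint_law_def
  by (intro prob_space.prob_space_distr measurable_process assms)

lemma distr_coordinate_joint_law:
  assumes "\<And>i. Y i \<in> borel_measurable M"
  shows "distr (joint_law M Y) borel (\<lambda>f. f i) = distr M borel (Y i)"
  unfolding joint_law_def using assms
  by (subst distr_distr) (auto intro: measurable_process simp: comp_def)

lemma stable_rv_coordinate:
  assumes "\<And>i. Y i \<in> borel_measurable M" and "stable_rv M r (Y i)"
  shows "stable_rv (joint_law M Y) r (\<lambda>f. f i)"
  using assms(2) distr_coordinate_joint_law[where i = i, OF assms(1)]
  by (simp add: stable_rv_def) (simp add: joint_law_def)

lemma indep_copies_coordinates:
  assumes M: "prob_space M" and Y: "\<And>i. Y i \<in> borel_measurable M"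
    and I: "I \<noteq> {}" and ind: "indep_copies M (Y k) I Y"
  shows "indep_copies (joint_law M Y) (\<lambda>f. f k) I (\<lambda>i f. f i)"
proof -
  interpret M: prob_space M by fact
  interpret N: prob_space "joint_law M Y" by (rule prob_space_joint_law[OF M Y])
  have coord: "(\<lambda>f. f i) \<in> borel_measurable (joint_law M Y)" for i
    by (simp add: joint_law_def)
  have "distr (joint_law M Y) (\<Pi>\<^sub>M i\<in>I. borel) (\<lambda>f. \<lambda>i\<in>I. f i)
      = distr M (\<Pi>\<^sub>M i\<in>I. borel) (\<lambda>\<omega>. \<lambda>i\<in>I. Y i \<omega>)"
    unfolding joint_law_def using Y
    by (subst distr_distr) (auto intro: measurable_process simp: comp_def)
  also have "\<dots> = (\<Pi>\<^sub>M i\<in>I. distr M borel (Y i))"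
    using M.indep_vars_iff_distr_eq_PiM'[OF I, where M' = "\<lambda>_. borel" and X = Y] Y ind
    by (simp add: indep_copies_def)
  also have "\<dots> = (\<Pi>\<^sub>M i\<in>I. distr (joint_law M Y) borel (\<lambda>f. f i))"
    by (simp add: distr_coordinate_joint_law[OF Y])
  finally have "N.indep_vars (\<lambda>_. borel) (\<lambda>i f. f i) I"
    using N.indep_vars_iff_distr_eq_PiM'[OF I, where M' = "\<lambda>_. borel" and X = "\<lambda>i f. f i"] coord by simp
  then show ?thesis
    using ind by (simp add: indep_copies_def distr_coordinate_joint_law[OF Y])
qed

lemma expected_max_joint_law:
  assumes M2: "prob_space M2"
    and X: "\<And>i. X i \<in> borel_measurable M1" and Y: "\<And>j. Y j \<in> borel_measurable M2"
  shows "expected_max (joint_law M1 X) (joint_law M2 Y) n m a (\<lambda>i f. f i) (\<lambda>j f. f j)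
       = expected_max M1 M2 n m a X Y"
proof -
  interpret M2: prob_space M2 by fact
  have [measurable]: "Y j \<in> borel_measurable M2" for j by (rule Y)
  have inner: "(\<integral>\<^sup>+g. ennreal (MAX (i, j)\<in>{1..n} \<times> {1..m}. \<bar>a i j * g j * f i\<bar>) \<partial>joint_law M2 Y)
      = (\<integral>\<^sup>+\<omega>2. ennreal (MAX (i, j)\<in>{1..n} \<times> {1..m}. \<bar>a i j * Y j \<omega>2 * f i\<bar>) \<partial>M2)" for f
    unfolding joint_law_def split_beta
    by (subst nn_integral_distr) (auto intro!: measurable_process Y)
  \<comment> \<open>The outer change of variables needs a measurable integrand.\<close>
  have "(\<lambda>f. \<integral>\<^sup>+\<omega>2. ennreal (MAX (i, j)\<in>{1..n} \<times> {1..m}. \<bar>a i j * Y j \<omega>2 * f i\<bar>) \<partial>M2)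
      \<in> borel_measurable (\<Pi>\<^sub>M i\<in>(UNIV :: nat set). borel)"
    unfolding split_beta by measurable
  then show ?thesis
    unfolding expected_max_def inner
    by (subst joint_law_def, subst nn_integral_distr) (auto intro!: measurable_process X)
qed

lemma stable_rv_indep_copy:
  assumes "prob_space M" and "stable_rv M r X0" and "indep_copies M X0 I X" and "i \<in> I"
  shows "stable_rv M r (X i)"
  using assms prob_space.indep_vars_def2[OF assms(1), of "\<lambda>_. borel" X I]
  by (auto simp: indep_copies_def stable_rv_def)

text \<open>
  An index outside \<open>I\<close> stores the model variable \<open>X0\<close>, so that one sequence carries the whole hypothesis;
  filling all remaining indices with \<open>X0\<close> keeps every coordinate measurable.
\<close>
lemma indep_copies_padded:
  assumes M: "prob_space M" and X0: "stable_rv M r X0" and X: "indep_copies M X0 I X" and k: "k \<notin> I"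
    and Y_def: "Y = (\<lambda>i. if i \<in> I then X i else X0)"
  shows "Y i \<in> borel_measurable M" and "stable_rv M r (Y k)" and "indep_copies M (Y k) I Y"
proof -
  show "Y i \<in> borel_measurable M"
    using X0 stable_rv_indep_copy[OF M X0 X] by (auto simp: Y_def stable_rv_def)
  show "stable_rv M r (Y k)" using X0 k by (simp add: Y_def)
  have "prob_space.indep_vars M (\<lambda>_. borel) Y I"
    using X prob_space.indep_vars_cong[OF M, of I I Y X "\<lambda>_. borel" "\<lambda>_. borel"]
    by (simp add: indep_copies_def Y_def)
  then show "indep_copies M (Y k) I Y"
    using X k by (auto simp: indep_copies_def Y_def)
qed

(* Constants existentially quantified in front of spaces over type variables 'a and 'b could depend on
   these types. So the constants are obtained in a statement without type variables, and every
   pair obtained there is asserted to serve for probability spaces over arbitrary types. *)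
theorem theorem2p1:
  fixes p q :: real
  assumes "1 < p" and "p < q" and "q < 2"
  shows "(\<exists>c>0. \<exists>C>0. \<forall>(N1 :: (nat \<Rightarrow> real) measure) (N2 :: (nat \<Rightarrow> real) measure).
            prob_space N1 \<longrightarrow> prob_space N2 \<longrightarrow> two_sided_estimate p q c C N1 N2) \<and>
         (\<forall>c>0. \<forall>C>0.
            (\<forall>(N1 :: (nat \<Rightarrow> real) measure) (N2 :: (nat \<Rightarrow> real) measure).
               prob_space N1 \<longrightarrow> prob_space N2 \<longrightarrow> two_sided_estimate p q c C N1 N2) \<longrightarrow>
            (\<forall>(M1 :: 'a measure) (M2 :: 'b measure).
               prob_space M1 \<longrightarrow> prob_space M2 \<longrightarrow> two_sided_estimate p q c C M1 M2))"
proof (intro conjI allI impI)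
  define c where "c = (1 - exp (- tail_const p)) * (1 - exp (- tail_const q))"
  define C where "C = 1 + 32 / (p - 1) * (1 + 32 / (q - p))"
  have "0 < tail_const r" for r by (simp add: tail_const_def)
  then have c: "c > 0" by (simp add: c_def)
  have C: "C > 0" using assms by (simp add: C_def add_pos_nonneg)
  have "two_sided_estimate p q c C N1 N2"
    if N: "prob_space N1" "prob_space N2" for N1 N2 :: "(nat \<Rightarrow> real) measure"
    unfolding two_sided_estimate_def
  proof (intro allI impI)
    fix n m :: nat and X0 X Y0 Y and a :: "nat \<Rightarrow> nat \<Rightarrow> real"
    assume nm: "1 \<le> n" "1 \<le> m"
      and H: "stable_rv N1 q X0 \<and> indep_copies N1 X0 {1..n} X \<and>
        stable_rv N2 p Y0 \<and> indep_copies N2 Y0 {1..m} Y"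
    have ind: "prob_space.indep_vars N1 (\<lambda>_. borel) X {1..n}" "prob_space.indep_vars N2 (\<lambda>_. borel) Y {1..m}"
      using H by (auto simp: indep_copies_def)
    have X: "stable_rv N1 q (X i)" if "i \<in> {1..n}" for i
      using H that by (blast intro: stable_rv_indep_copy[OF N(1)])
    have Y: "stable_rv N2 p (Y j)" if "j \<in> {1..m}" for j
      using H that by (blast intro: stable_rv_indep_copy[OF N(2)])
    show "ennreal (c * mixed_norm p q n m a) \<le> expected_max N1 N2 n m a X Y \<and>
        expected_max N1 N2 n m a X Y \<le> ennreal (C * mixed_norm p q n m a)"
      unfolding expected_max_def mixed_norm_def c_def C_def
      using assms nm X Y ind
      by (intro conjI nested_expected_max_ge nested_expected_max_le N) auto
  qed
  then show "\<exists>c>0. \<exists>C>0. \<forall>(N1 :: (nat \<Rightarrow> real) measure) (N2 :: (nat \<Rightarrow> real) measure).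
            prob_space N1 \<longrightarrow> prob_space N2 \<longrightarrow> two_sided_estimate p q c C N1 N2"
    using c C by blast
next
  fix c C :: real and M1 :: "'a measure" and M2 :: "'b measure"
  assume est: "\<forall>(N1 :: (nat \<Rightarrow> real) measure) (N2 :: (nat \<Rightarrow> real) measure).
               prob_space N1 \<longrightarrow> prob_space N2 \<longrightarrow> two_sided_estimate p q c C N1 N2"
    and M: "prob_space M1" "prob_space M2"
  show "two_sided_estimate p q c C M1 M2"
    unfolding two_sided_estimate_def
  proof (intro allI impI)
    fix n m :: nat and X0 X Y0 Y and a :: "nat \<Rightarrow> nat \<Rightarrow> real"
    assume nm: "1 \<le> n" "1 \<le> m"
      and H: "stable_rv M1 q X0 \<and> indep_copies M1 X0 {1..n} X \<and>
        stable_rv M2 p Y0 \<and> indep_copies M2 Y0 {1..m} Y"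
    \<comment> \<open>Coordinate 0 lies outside both index sets and carries the model variable.\<close>
    define X' where "X' = (\<lambda>i. if i \<in> {1..n} then X i else X0)"
    define Y' where "Y' = (\<lambda>j. if j \<in> {1..m} then Y j else Y0)"
    have H': "stable_rv M1 q X0" "indep_copies M1 X0 {1..n} X" "stable_rv M2 p Y0" "indep_copies M2 Y0 {1..m} Y"
      using H by auto
    have zero: "0 \<notin> {1..n}" "0 \<notin> {1..m}" by auto
    note X' = indep_copies_padded[OF M(1) H'(1,2) zero(1) X'_def]
    note Y' = indep_copies_padded[OF M(2) H'(3,4) zero(2) Y'_def]
    have "two_sided_estimate p q c C (joint_law M1 X') (joint_law M2 Y')"
      using est prob_space_joint_law[where Y = X', OF M(1) X'(1)] prob_space_joint_law[where Y = Y', OF M(2) Y'(1)]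
      by blast
    moreover have "stable_rv (joint_law M1 X') q (\<lambda>f. f 0)" "stable_rv (joint_law M2 Y') p (\<lambda>f. f 0)"
      by (intro stable_rv_coordinate X' Y')+
    moreover have "indep_copies (joint_law M1 X') (\<lambda>f. f 0) {1..n} (\<lambda>i f. f i)"
      "indep_copies (joint_law M2 Y') (\<lambda>f. f 0) {1..m} (\<lambda>i f. f i)"
      using nm by (intro indep_copies_coordinates M X' Y'; simp)+
    ultimately have
      "ennreal (c * mixed_norm p q n m a)
         \<le> expected_max (joint_law M1 X') (joint_law M2 Y') n m a (\<lambda>i f. f i) (\<lambda>j f. f j) \<and>
       expected_max (joint_law M1 X') (joint_law M2 Y') n m a (\<lambda>i f. f i) (\<lambda>j f. f j)
         \<le> ennreal (C * mixed_norm p q n m a)"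
      using nm unfolding two_sided_estimate_def by blast
    moreover have "expected_max M1 M2 n m a X' Y' = expected_max M1 M2 n m a X Y"
      unfolding expected_max_def X'_def Y'_def
      by (intro nn_integral_cong arg_cong[where f = ennreal] arg_cong[where f = Max] image_cong) auto
    ultimately show "ennreal (c * mixed_norm p q n m a) \<le> expected_max M1 M2 n m a X Y \<and>
        expected_max M1 M2 n m a X Y \<le> ennreal (C * mixed_norm p q n m a)"
      by (simp add: expected_max_joint_law[OF M(2) X'(1) Y'(1)])
  qed
qed

end
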